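(* Let $\mathbf{k}$ be a field of characteristic zero and $B$ a factorial affine $\mathbf{k}$-domain. Suppose that $A_0\subsetneq\cdots\subsetneq A_n$ is a chain of elements of $\mathcal{A}(B)$ satisfying $n\ge 1$ and $\operatorname{trdeg}(A_i:A_{i-1})=1$ for all $i\in\{1,\dots,n\}$. Then $A_{i-1}\in\mathcal{A}_1^*(A_i)$ for all $i\in\{1,\dots,n\}$. In particular, $\operatorname{Frac} A_n=(\operatorname{Frac} A_0)^{(n)}$.
   Context: All rings are commutative with unity; "domain" means integral domain; "factorial" means UFD. An affine $\mathbf{k}$-domain is a domain that is a finitely generated $\mathbf{k}$-algebra. A derivation $D:B\to B$ is locally nilpotent if for each $x\in B$ there is $n\in\mathbb{N}$ with $D^n(x)=0$; $\operatorname{LND}(B)$ is the set of locally nilpotent derivations $B\to B$. For a domain $B$ of characteristic zero and $\Delta\subseteq\operatorname{LND}(B)$, put $A_\Delta=\bigcap_{D\in\Delta}\ker D$ (intersection in $B$, $A_\emptyset=B$), and $\mathcal{A}(B)=\{A_\Delta:\Delta\subseteq\operatorname{LND}(B)\}$. For domains $R\subseteq A$, $\operatorname{trdeg}(A:R)$ is the transcendence degree of $\operatorname{Frac} A$ over $\operatorname{Frac} R$. For a domain $A$, $\mathcal{A}_1^*(A)$ is the set of subrings $R$ of $A$ such that $R$ is algebraically closed in $A$ and, with $S=R\setminus\{0\}$, $S^{-1}A$ is a polynomial ring in one variable over the field $S^{-1}R=\operatorname{Frac} R$. For fields, $L=K^{(n)}$ means that $L$ is a purely transcendental extension of $K$ of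 transcendence degree $n$. *)

theory Defs
  imports
    Complex_Main
    "HOL-Library.Poly_Mapping"
    "HOL-Computational_Algebra.Polynomial"
    "HOL-Computational_Algebra.Factorial_Ring"
    "HOL-Computational_Algebra.Fraction_Field"
begin

definition subring_of :: "'a::comm_ring_1 set \<Rightarrow> bool" where
  "subring_of R \<longleftrightarrow> 1 \<in> R \<and> (\<forall>x\<in>R. \<forall>y\<in>R. x - y \<in> R \<and> x * y \<in> R)"

definition subfield_of :: "'a::field set \<Rightarrow> bool" where
  "subfield_of K \<longleftrightarrow> subring_of K \<and> (\<forall>x\<in>K. inverse x \<in> K)"

locale commutative_algebra = vector_space scale
  for scale :: "'k::field \<Rightarrow> 'b::comm_ring_1 \<Rightarrow> 'b" +
  assumes scale_mult_left: "scale c (x * y) = scale c x * y"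

definition subalgebra_of :: "('k::field \<Rightarrow> 'b::comm_ring_1 \<Rightarrow> 'b) \<Rightarrow> 'b set \<Rightarrow> bool" where
  "subalgebra_of scale S \<longleftrightarrow> subring_of S \<and> (\<forall>c. \<forall>x\<in>S. scale c x \<in> S)"

definition affine_algebra :: "('k::field \<Rightarrow> 'b::comm_ring_1 \<Rightarrow> 'b) \<Rightarrow> bool" where
  "affine_algebra scale \<longleftrightarrow>
     commutative_algebra scale \<and> (\<exists>G. finite G \<and> subalgebra_of scale hull G = UNIV)"

definition derivation :: "('b::comm_ring_1 \<Rightarrow> 'b) \<Rightarrow> bool" where
  "derivation D \<longleftrightarrow> (\<forall>x y. D (x + y) = D x + D y) \<and> (\<forall>x y. D (x * y) = D x * y + x * D y)"

definition LND :: "('b::comm_ring_1 \<Rightarrow> 'b) set" where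
  "LND = {D. derivation D \<and> (\<forall>x. \<exists>n. (D ^^ n) x = 0)}"

text \<open>For \<open>\<Delta> = {}\<close> the intersection is taken in the whole ring, so it is \<open>UNIV\<close>.\<close>

definition common_kernel :: "('b::comm_ring_1 \<Rightarrow> 'b) set \<Rightarrow> 'b set" where
  "common_kernel \<Delta> = (\<Inter>D\<in>\<Delta>. {x. D x = 0})"

definition kernel_rings :: "'b::comm_ring_1 set set" where
  "kernel_rings = {common_kernel \<Delta> | \<Delta>. \<Delta> \<subseteq> LND}"

text \<open>
  For a subring \<open>A\<close> of a domain of type \<open>'b\<close> and \<open>S \<subseteq> A - {0}\<close> multiplicative, the ring
  \<open>S\<^sup>-\<^sup>1A\<close> is realized inside the fraction field \<open>'b fract\<close>. In particular, the fraction
  fields of all subrings are subfields of one common field.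
\<close>

definition localization :: "'b::idom set \<Rightarrow> 'b set \<Rightarrow> 'b fract set" where
  "localization S A = {Fract a s | a s. a \<in> A \<and> s \<in> S}"

definition Frac :: "'b::idom set \<Rightarrow> 'b fract set" where
  "Frac A = localization (A - {0}) A"

definition polys_over :: "'a::comm_ring_1 set \<Rightarrow> 'a poly set" where
  "polys_over R = {p. \<forall>i. coeff p i \<in> R}"

definition algebraic_over :: "'a::comm_ring_1 set \<Rightarrow> 'a \<Rightarrow> bool" where
  "algebraic_over R x \<longleftrightarrow> (\<exists>p\<in>polys_over R. p \<noteq> 0 \<and> poly p x = 0)"

definition algebraically_closed_in :: "'a::comm_ring_1 set \<Rightarrow> 'a set \<Rightarrow> bool" where
  "algebraically_closed_in R A \<longleftrightarrow> (\<forall>x\<in>A. algebraic_over R x \<longrightarrow> x \<in> R)"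

text \<open>
  A multivariate polynomial is a finitely supported map from monomials to coefficients, where
  a monomial is a finitely supported map from variables to exponents. The variables are the
  elements of the ring themselves, and evaluation substitutes each element for itself.
\<close>

definition eval_self :: "(('a::comm_ring_1 \<Rightarrow>\<^sub>0 nat) \<Rightarrow>\<^sub>0 'a) \<Rightarrow> 'a" where
  "eval_self p =
     (\<Sum>m\<in>Poly_Mapping.keys p.
        Poly_Mapping.lookup p m * (\<Prod>x\<in>Poly_Mapping.keys m. x ^ Poly_Mapping.lookup m x))"

definition mpolys_over :: "'a::comm_ring_1 set \<Rightarrow> 'a set \<Rightarrow> (('a \<Rightarrow>\<^sub>0 nat) \<Rightarrow>\<^sub>0 'a) set" where
  "mpolys_over K X =
     {p. (\<forall>m. Poly_Mapping.lookup p m \<in> K) \<and>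
         (\<forall>m\<in>Poly_Mapping.keys p. Poly_Mapping.keys m \<subseteq> X)}"

definition algebraically_independent :: "'a::field set \<Rightarrow> 'a set \<Rightarrow> bool" where
  "algebraically_independent K X \<longleftrightarrow> (\<forall>p\<in>mpolys_over K X. eval_self p = 0 \<longrightarrow> p = 0)"

definition adjoin :: "'a::field set \<Rightarrow> 'a set \<Rightarrow> 'a set" where
  "adjoin K X = subfield_of hull (K \<union> X)"

definition transcendence_basis :: "'a::field set \<Rightarrow> 'a set \<Rightarrow> 'a set \<Rightarrow> bool" where
  "transcendence_basis K L X \<longleftrightarrow>
     X \<subseteq> L \<and> algebraically_independent K X \<and> (\<forall>y\<in>L. algebraic_over (adjoin K X) y)"

text \<open>
  The relation \<open>trdeg(A : R) = n\<close> for a natural number \<open>n\<close>; functional in \<open>n\<close> because all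
  transcendence bases of a field extension have the same cardinality.
\<close>

definition has_trdeg :: "'b::idom set \<Rightarrow> 'b set \<Rightarrow> nat \<Rightarrow> bool" where
  "has_trdeg A R n \<longleftrightarrow>
     (\<exists>X. transcendence_basis (Frac R) (Frac A) X \<and> finite X \<and> card X = n)"

definition purely_transcendental :: "'a::field set \<Rightarrow> 'a set \<Rightarrow> nat \<Rightarrow> bool" where
  "purely_transcendental K L n \<longleftrightarrow>
     (\<exists>X. finite X \<and> card X = n \<and> algebraically_independent K X \<and> L = adjoin K X)"

definition polynomial_ring_in_one_variable :: "'a::comm_ring_1 set \<Rightarrow> 'a set \<Rightarrow> bool" where
  "polynomial_ring_in_one_variable K P \<longleftrightarrow>
     (\<exists>t. \<not> algebraic_over K t \<and> P = (\<lambda>p. poly p t) ` polys_over K)"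

definition A1_star :: "'b::idom set \<Rightarrow> 'b set set" where
  "A1_star A =
     {R. subring_of R \<and> R \<subseteq> A \<and> algebraically_closed_in R A \<and>
         polynomial_ring_in_one_variable (Frac R) (localization (R - {0}) A)}"

end

theory Submission
  imports Defs
begin

text \<open>
  Let \<open>R \<subset> A\<close> be two consecutive rings of the chain.  The point is that \<open>A\<close> becomes a polynomial
  ring in one variable after the nonzero elements of \<open>R\<close> are inverted; iterating this along the
  chain, and using that a tower of simple transcendental extensions is purely transcendental, gives
  the statement about fraction fields.

  Choose a locally nilpotent derivation \<open>D\<close> that vanishes on \<open>R\<close> but not on \<open>A\<close>.  It need not map
  \<open>A\<close> into \<open>A\<close>.  It does so up to a common factor, however: because \<open>A\<close> has transcendence degree
  one over \<open>R\<close>, implicit differentiation shows that for all \<open>a\<close> and \<open>p\<close> in \<open>A\<close> with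
  \<open>D p \<noteq> 0\<close> there are \<open>u \<noteq> 0\<close> and \<open>w\<close> in \<open>A\<close> with \<open>u * D a = w * D p\<close>, and the same \<open>u\<close> and
  \<open>w\<close> serve every derivation vanishing on \<open>R\<close> (\<open>derivations_proportional_on_trdeg_1\<close>).  In
  particular, the elements of \<open>A\<close> killed by \<open>D\<close> are those of \<open>R\<close>.

  Now let \<open>p\<close> have the least \<open>D\<close>-degree among the elements of \<open>A\<close> outside \<open>R\<close>.  Since \<open>A\<close> is
  factorially closed, a prime factor of \<open>u\<close> lies in \<open>A\<close>; if it is not in \<open>R\<close>, its degree is at least
  that of \<open>p\<close>, so it cannot divide \<open>D p\<close> and must divide \<open>w\<close>.  Cancelling all these factors leaves
  \<open>u\<close> in \<open>R\<close> (\<open>clear_slope_denominator\<close>).  In other words, \<open>a \<mapsto> D a / D p\<close> is a derivation of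
  the localization of \<open>A\<close> with value \<open>1\<close> at \<open>p\<close>, and it lowers degrees.  Integrating repeatedly
  therefore expresses every element of \<open>A\<close> as a polynomial in \<open>p\<close> with coefficients in the
  fraction field of \<open>R\<close> (\<open>slope_descent\<close>).
\<close>

section \<open>Subrings and subfields\<close>

lemma subring_of_diff: "subring_of R \<Longrightarrow> x \<in> R \<Longrightarrow> y \<in> R \<Longrightarrow> x - y \<in> R"
  and subring_of_mult: "subring_of R \<Longrightarrow> x \<in> R \<Longrightarrow> y \<in> R \<Longrightarrow> x * y \<in> R"
  and subring_of_1: "subring_of R \<Longrightarrow> 1 \<in> R"
  by (auto simp: subring_of_def)

lemma subring_of_0: "subring_of R \<Longrightarrow> 0 \<in> R"
  using subring_of_diff[of R 1 1] subring_of_1[of R] by simp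

lemma subring_of_uminus: "subring_of R \<Longrightarrow> x \<in> R \<Longrightarrow> - x \<in> R"
  using subring_of_diff[of R 0 x] subring_of_0[of R] by simp

lemma subring_of_add: "subring_of R \<Longrightarrow> x \<in> R \<Longrightarrow> y \<in> R \<Longrightarrow> x + y \<in> R"
  using subring_of_diff[of R x "- y"] subring_of_uminus[of R y] by simp

lemma subring_of_sum: "subring_of R \<Longrightarrow> (\<And>i. i \<in> I \<Longrightarrow> f i \<in> R) \<Longrightarrow> sum f I \<in> R"
  by (induction I rule: infinite_finite_induct) (auto intro: subring_of_add subring_of_0)

lemma subring_of_prod: "subring_of R \<Longrightarrow> (\<And>i. i \<in> I \<Longrightarrow> f i \<in> R) \<Longrightarrow> prod f I \<in> R"
  by (induction I rule: infinite_finite_induct) (auto intro: subring_of_mult subring_of_1)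

lemma subring_of_power: "subring_of R \<Longrightarrow> x \<in> R \<Longrightarrow> x ^ n \<in> R"
  by (induction n) (auto intro: subring_of_mult subring_of_1)

lemma subring_of_of_nat: "subring_of R \<Longrightarrow> of_nat n \<in> R"
  by (induction n) (auto intro: subring_of_add subring_of_1 subring_of_0)

lemmas subring_of_closed =
  subring_of_diff subring_of_mult subring_of_1 subring_of_0 subring_of_uminus subring_of_add
  subring_of_sum subring_of_prod subring_of_power subring_of_of_nat

lemma subfield_of_subring: "subfield_of K \<Longrightarrow> subring_of K"
  and subfield_of_inverse: "subfield_of K \<Longrightarrow> x \<in> K \<Longrightarrow> inverse x \<in> K"
  by (auto simp: subfield_of_def)

lemma subfield_of_divide: "subfield_of K \<Longrightarrow> x \<in> K \<Longrightarrow> y \<in> K \<Longrightarrow> x / y \<in> K"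
  by (simp add: divide_inverse subfield_of_inverse subfield_of_subring subring_of_mult)

lemma subfield_of_adjoin: "subfield_of (adjoin K X)"
proof -
  have "subfield_of (\<Inter>\<F>)" if sub: "\<And>M. M \<in> \<F> \<Longrightarrow> subfield_of M" for \<F> :: "'a set set"
    unfolding subfield_of_def subring_of_def
  proof (intro conjI ballI InterI)
    fix M x y assume M: "M \<in> \<F>" and "x \<in> \<Inter>\<F>" "y \<in> \<Inter>\<F>"
    then have "x \<in> M" "y \<in> M" by auto
    with sub[OF M] show "x - y \<in> M" "x * y \<in> M"
      by (simp_all add: subfield_of_subring subring_of_diff subring_of_mult)
  next
    fix M x assume M: "M \<in> \<F>" and "x \<in> \<Inter>\<F>"
    then have "x \<in> M" by auto
    with sub[OF M] show "inverse x \<in> M" by (simp add: subfield_of_inverse)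
  qed (simp add: sub subfield_of_subring subring_of_1)
  then show ?thesis
    unfolding adjoin_def using hull_in[of subfield_of "K \<union> X"] by blast
qed

lemma adjoin_upper: "K \<union> X \<subseteq> adjoin K X"
  using hull_subset[of "K \<union> X" subfield_of] by (auto simp: adjoin_def)

lemma adjoin_least: "subfield_of M \<Longrightarrow> K \<subseteq> M \<Longrightarrow> X \<subseteq> M \<Longrightarrow> adjoin K X \<subseteq> M"
  unfolding adjoin_def by (intro hull_minimal) auto

lemma adjoin_empty: "subfield_of K \<Longrightarrow> adjoin K {} = K"
  using adjoin_upper[of K "{}"] adjoin_least[of K K "{}"] by simp

lemma adjoin_adjoin: "adjoin (adjoin K X) Y = adjoin K (X \<union> Y)"
proof (rule equalityI)
  have "K \<union> X \<subseteq> adjoin K (X \<union> Y)" "Y \<subseteq> adjoin K (X \<union> Y)"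
    using adjoin_upper[of K "X \<union> Y"] by simp_all
  then show "adjoin (adjoin K X) Y \<subseteq> adjoin K (X \<union> Y)"
    by (meson adjoin_least subfield_of_adjoin le_sup_iff)
  have "K \<union> X \<subseteq> adjoin (adjoin K X) Y" "Y \<subseteq> adjoin (adjoin K X) Y"
    using adjoin_upper[of K X] adjoin_upper[of "adjoin K X" Y] by (meson le_sup_iff order.trans)+
  then show "adjoin K (X \<union> Y) \<subseteq> adjoin (adjoin K X) Y"
    by (meson adjoin_least subfield_of_adjoin le_sup_iff)
qed

lemma polys_over_pCons: "pCons c p \<in> polys_over R \<longleftrightarrow> c \<in> R \<and> p \<in> polys_over R"
proof
  assume "pCons c p \<in> polys_over R"
  then have "coeff (pCons c p) i \<in> R" for i by (simp add: polys_over_def)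
  from this[of 0] this[of "Suc _"] show "c \<in> R \<and> p \<in> polys_over R"
    by (simp add: polys_over_def)
qed (auto simp: polys_over_def coeff_pCons split: nat.splits)

lemma polys_over_add:
  "subring_of R \<Longrightarrow> p \<in> polys_over R \<Longrightarrow> q \<in> polys_over R \<Longrightarrow> p + q \<in> polys_over R"
  by (simp add: polys_over_def subring_of_add)

lemma polys_over_mono: "R \<subseteq> S \<Longrightarrow> p \<in> polys_over R \<Longrightarrow> p \<in> polys_over S"
  by (auto simp: polys_over_def)

lemma polys_over_pderiv:
  fixes p :: "'a::idom poly"
  shows "subring_of R \<Longrightarrow> p \<in> polys_over R \<Longrightarrow> pderiv p \<in> polys_over R"
  by (simp add: polys_over_def coeff_pderiv subring_of_mult subring_of_of_nat del: of_nat_Suc)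

lemma poly_in_subring:
  assumes "subring_of R" "p \<in> polys_over R" "x \<in> R"
  shows "poly p x \<in> R"
  using assms(2)
proof (induction p)
  case (pCons c p)
  then show ?case
    by (simp add: polys_over_pCons subring_of_add subring_of_mult assms(1,3))
qed (simp add: subring_of_0 assms(1))

lemma of_nat_nonzero_if_CHAR_0:
  "CHAR('a::semiring_1) = 0 \<Longrightarrow> n > 0 \<Longrightarrow> of_nat n \<noteq> (0::'a)"
  by (simp add: CHAR_eq0_iff)

text \<open>
  Among the nonzero polynomials over \<open>R\<close> that vanish at \<open>x\<close>, one of least degree has \<open>x\<close> as a
  simple root, since its derivative is a nonzero polynomial of smaller degree.  This is where
  characteristic zero enters the treatment of algebraic elements.
\<close>

lemma algebraic_over_simple_root:
  fixes x :: "'a::idom"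
  assumes char: "CHAR('a) = 0" and R: "subring_of R" and alg: "algebraic_over R x"
  obtains P where "P \<in> polys_over R" "poly P x = 0" "poly (pderiv P) x \<noteq> 0"
proof -
  let ?Q = "\<lambda>P. P \<in> polys_over R \<and> P \<noteq> 0 \<and> poly P x = 0"
  have "\<exists>P. ?Q P"
    using alg by (auto simp: algebraic_over_def)
  then obtain P where P: "?Q P" and min: "\<And>P'. ?Q P' \<Longrightarrow> degree P \<le> degree P'"
    using ex_has_least_nat[of ?Q _ degree] by blast
  have "degree P \<noteq> 0"
  proof
    assume "degree P = 0"
    then obtain c where "P = [:c:]" by (auto elim: degree_eq_zeroE)
    with P show False by simp
  qed
  then obtain k where k: "degree P = Suc k" by (cases "degree P") auto
  have "coeff (pderiv P) k \<noteq> 0"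
    using of_nat_nonzero_if_CHAR_0[OF char, of "degree P"] P k[symmetric]
    by (simp add: coeff_pderiv del: of_nat_Suc)
  then have "pderiv P \<noteq> 0" by auto
  moreover have "degree (pderiv P) \<le> k"
    by (intro degree_le) (auto simp: coeff_pderiv coeff_eq_0 k)
  ultimately have "poly (pderiv P) x \<noteq> 0"
    using min[of "pderiv P"] P polys_over_pderiv[OF R, of P] k by fastforce
  with P that show thesis by blast
qed


section \<open>Derivations\<close>

lemma derivation_add: "derivation D \<Longrightarrow> D (x + y) = D x + D y"
  and derivation_mult: "derivation D \<Longrightarrow> D (x * y) = D x * y + x * D y"
  by (auto simp: derivation_def)

lemma derivation_0: "derivation D \<Longrightarrow> D 0 = 0"
  using derivation_add[of D 0 0] by simp

lemma derivation_1: "derivation D \<Longrightarrow> D 1 = 0"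
  using derivation_mult[of D 1 1] by simp

lemma derivation_uminus: "derivation D \<Longrightarrow> D (- x) = - D x"
  using derivation_add[of D x "- x"] derivation_0[of D]
  by (simp add: eq_neg_iff_add_eq_0 add.commute)

lemma derivation_diff: "derivation D \<Longrightarrow> D (x - y) = D x - D y"
  using derivation_add[of D x "- y"] derivation_uminus[of D y] by simp

lemma derivation_inverse:
  fixes x :: "'a::field"
  assumes "derivation D" "x \<noteq> 0"
  shows "D (inverse x) = - D x / x\<^sup>2"
proof -
  have "D x * inverse x + x * D (inverse x) = 0"
    using derivation_mult[OF assms(1), of x "inverse x"] derivation_1[OF assms(1)] assms(2) by simp
  then have "x * D (inverse x) = - (D x * inverse x)"
    by (simp add: eq_neg_iff_add_eq_0 add.commute)
  then show ?thesis
    using assms(2) by (simp add: field_simps power2_eq_square)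
qed

lemma derivation_poly:
  assumes D: "derivation D"
  shows "D (poly p x) = poly (map_poly D p) x + poly (pderiv p) x * D x"
  by (induction p)
    (simp_all add: derivation_0[OF D] derivation_add[OF D] derivation_mult[OF D] pderiv_pCons
      map_poly_pCons algebra_simps)

lemma derivation_poly_const:
  assumes "derivation D" "p \<in> polys_over R" "\<And>r. r \<in> R \<Longrightarrow> D r = 0"
  shows "D (poly p x) = poly (pderiv p) x * D x"
proof -
  have "map_poly D p = 0"
    using assms by (intro poly_eqI) (simp add: coeff_map_poly derivation_0 polys_over_def)
  then show ?thesis by (simp add: derivation_poly[OF assms(1)])
qed

lemma derivation_algebraic_eq_0:
  fixes x :: "'a::idom"
  assumes "CHAR('a) = 0" "subring_of R" "algebraic_over R x"
    and D: "derivation D" "\<And>r. r \<in> R \<Longrightarrow> D r = 0"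
  shows "D x = 0"
proof -
  obtain P where P: "P \<in> polys_over R" "poly P x = 0" "poly (pderiv P) x \<noteq> 0"
    using algebraic_over_simple_root assms by blast
  show ?thesis
    using derivation_poly_const[OF D(1) P(1) D(2), of x] P derivation_0[OF D(1)] by simp
qed

text \<open>
  Over a field extension of the form \<open>K(z)\<close>, a \<open>K\<close>-derivation is determined by its value at
  \<open>z\<close>, and this persists for elements algebraic over \<open>K(z)\<close>: implicit differentiation gives
  \<open>E y = f * E z\<close> with one factor \<open>f\<close> that serves all \<open>K\<close>-derivations \<open>E\<close> at the same time.
  Because \<open>f\<close> lies in any prescribed field that contains \<open>K\<close>, \<open>y\<close> and \<open>z\<close>, no derivation has
  to map that field into itself.
\<close>

lemma derivations_proportional:
  fixes K :: "'a::field set"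
  assumes char: "CHAR('a) = 0" and M: "subfield_of M" and "K \<subseteq> M" "z \<in> M" "y \<in> M"
    and alg: "algebraic_over (adjoin K {z}) y"
  obtains f where "f \<in> M"
    and "\<And>E. derivation E \<Longrightarrow> (\<And>k. k \<in> K \<Longrightarrow> E k = 0) \<Longrightarrow> E y = f * E z"
proof -
  note M' = subfield_of_subring[OF M]
  define der where "der E \<longleftrightarrow> derivation E \<and> (\<forall>k\<in>K. E k = 0)" for E :: "'a \<Rightarrow> 'a"
  have derD: "derivation E" if "der E" for E
    using that by (simp add: der_def)
  \<comment> \<open>The elements of \<open>M\<close> at which all \<open>K\<close>-derivations are proportional to their value at \<open>z\<close>;
    they form a field.\<close>
  define N where "N = {x \<in> M. \<exists>f\<in>M. \<forall>E. der E \<longrightarrow> E x = f * E z}"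
  have NI: "x \<in> N" if "x \<in> M" "f \<in> M" "\<And>E. der E \<Longrightarrow> E x = f * E z" for x f
    using that by (auto simp: N_def)
  have "subfield_of N"
    unfolding subfield_of_def subring_of_def
  proof (intro conjI ballI)
    show "1 \<in> N"
      by (rule NI[of 1 0]) (auto simp: derivation_1 derD intro: subring_of_closed M')
  next
    fix x y assume xy: "x \<in> N" "y \<in> N"
    then obtain f g where f: "f \<in> M" "\<And>E. der E \<Longrightarrow> E x = f * E z"
      and g: "g \<in> M" "\<And>E. der E \<Longrightarrow> E y = g * E z" and xyM: "x \<in> M" "y \<in> M"
      by (auto simp: N_def)
    show "x - y \<in> N"
      by (rule NI[of _ "f - g"])
        (auto simp: derivation_diff derD f g xyM algebra_simps intro!: subring_of_closed M')
    show "x * y \<in> N"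
      by (rule NI[of _ "f * y + x * g"])
        (auto simp: derivation_mult derD f g xyM algebra_simps intro!: subring_of_closed M')
  next
    fix x assume x: "x \<in> N"
    then obtain f where f: "f \<in> M" "\<And>E. der E \<Longrightarrow> E x = f * E z" and xM: "x \<in> M"
      by (auto simp: N_def)
    show "inverse x \<in> N"
    proof (cases "x = 0")
      case False
      show ?thesis
        by (rule NI[of _ "- f / x\<^sup>2"])
          (auto simp: derivation_inverse derD f xM False
            intro!: subring_of_closed M' subfield_of_inverse M subfield_of_divide)
    qed (use x in simp)
  qed
  moreover have "K \<subseteq> N"
    using \<open>K \<subseteq> M\<close> by (auto intro!: NI[of _ 0] simp: der_def subring_of_0 M')
  moreover have "z \<in> N"
    using \<open>z \<in> M\<close> by (auto intro!: NI[of _ 1] simp: subring_of_1 M')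
  ultimately have sub: "adjoin K {z} \<subseteq> N"
    by (simp add: adjoin_least)
  \<comment> \<open>Implicit differentiation of \<open>P y = 0\<close>, solved for \<open>E y\<close>, which is possible at a simple root.\<close>
  obtain P where P: "P \<in> polys_over (adjoin K {z})" "poly P y = 0" "poly (pderiv P) y \<noteq> 0"
    using algebraic_over_simple_root[OF char subfield_of_subring[OF subfield_of_adjoin] alg] .
  have PN: "P \<in> polys_over N"
    using P(1) sub polys_over_mono by blast
  then have PM: "P \<in> polys_over M"
    by (auto simp: polys_over_def N_def)
  have "\<exists>g\<in>M. \<forall>E. der E \<longrightarrow> poly (map_poly E Q) y = g * E z" if "Q \<in> polys_over N" for Q
    using that
  proof (induction Q)
    case 0
    show ?case by (intro bexI[of _ 0]) (auto simp: subring_of_0 M')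
  next
    case (pCons c Q)
    then obtain g where g: "g \<in> M" "\<And>E. der E \<Longrightarrow> poly (map_poly E Q) y = g * E z"
      by (auto simp: polys_over_pCons)
    obtain f where f: "f \<in> M" "\<And>E. der E \<Longrightarrow> E c = f * E z"
      using pCons.prems by (auto simp: polys_over_pCons N_def)
    show ?case
    proof (intro bexI[of _ "f + y * g"] allI impI)
      show "f + y * g \<in> M"
        using f g \<open>y \<in> M\<close> by (auto intro!: subring_of_closed M')
      fix E assume E: "der E"
      show "poly (map_poly E (pCons c Q)) y = (f + y * g) * E z"
        using f(2)[OF E] g(2)[OF E] derivation_0[OF derD[OF E]]
        by (simp add: map_poly_pCons algebra_simps)
    qed
  qed
  from this[OF PN] obtain g
    where g: "g \<in> M" "\<And>E. der E \<Longrightarrow> poly (map_poly E P) y = g * E z" by blast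
  let ?d = "poly (pderiv P) y"
  have dM: "?d \<in> M"
    using PM \<open>y \<in> M\<close> by (intro poly_in_subring polys_over_pderiv M')
  show thesis
  proof (rule that[of "- g / ?d"])
    show "- g / ?d \<in> M"
      using g(1) dM by (intro subfield_of_divide M subring_of_uminus M')
    fix E assume "derivation E" "\<And>k. k \<in> K \<Longrightarrow> E k = 0"
    then have E: "der E" by (simp add: der_def)
    have "g * E z + ?d * E y = 0"
      using derivation_poly[OF derD[OF E], of P y] P(2) derivation_0[OF derD[OF E]] g(2)[OF E]
      by simp
    then have "?d * E y = - (g * E z)"
      by (simp add: eq_neg_iff_add_eq_0 add.commute)
    then show "E y = - g / ?d * E z"
      using P(3) by (simp add: field_simps)
  qed
qed


section \<open>Rings of fractions\<close>

lemma Fract_eq_iff: "b \<noteq> 0 \<Longrightarrow> d \<noteq> 0 \<Longrightarrow> Fract a b = Fract c d \<longleftrightarrow> a * d = c * b"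
  for a :: "'a::idom"
  by (rule eq_fract(1))

lemma Fract_1_eq_0_iff: "Fract a 1 = 0 \<longleftrightarrow> a = (0::'a::idom)"
  by (simp add: Zero_fract_def Fract_eq_iff)

lemma Fract_eq_divide: "Fract a b = Fract a 1 / Fract b (1::'a::idom)"
  by simp

lemma CHAR_fract: "CHAR('a::idom) = 0 \<Longrightarrow> CHAR('a fract) = 0"
  by (simp add: CHAR_eq0_iff of_nat_fract Zero_fract_def Fract_eq_iff)

text \<open>
  The extension is given by the quotient rule.  Its value does not depend on the representation of
  a fraction: for \<open>Fract a b = Fract c d\<close>, apply \<open>D\<close> to \<open>a * d = c * b\<close>.
\<close>

lemma derivation_extends_to_fract:
  fixes D :: "'a::idom \<Rightarrow> 'a"
  assumes D: "derivation D"
  obtains E where "derivation E" "\<And>x. E (Fract x 1) = Fract (D x) 1"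
proof -
  define E where "E x = (SOME y. \<exists>a b. b \<noteq> 0 \<and> x = Fract a b
      \<and> y = Fract (D a * b - a * D b) (b * b))" for x
  have E: "E (Fract a b) = Fract (D a * b - a * D b) (b * b)" if b: "b \<noteq> 0" for a b
  proof -
    have "\<exists>y. \<exists>a' b'. b' \<noteq> 0 \<and> Fract a b = Fract a' b'
        \<and> y = Fract (D a' * b' - a' * D b') (b' * b')"
      using b by blast
    from someI_ex[OF this] obtain c d where cd: "d \<noteq> 0" "Fract a b = Fract c d"
      "E (Fract a b) = Fract (D c * d - c * D d) (d * d)"
      unfolding E_def by blast
    have eq: "a * d = c * b"
      using cd b by (simp add: Fract_eq_iff)
    then have "D (a * d) = D (c * b)" by simp
    then have "D a * d + a * D d = D c * b + c * D b"
      by (simp add: derivation_mult[OF D])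
    moreover have "(D c * d - c * D d) * (b * b) - (D a * b - a * D b) * (d * d)
       = b * d * ((D c * b + c * D b) - (D a * d + a * D d)) + (b * D d + d * D b) * (a * d - c * b)"
      by (simp add: algebra_simps)
    ultimately have "(D c * d - c * D d) * (b * b) = (D a * b - a * D b) * (d * d)"
      using eq by simp
    then show ?thesis
      using cd b by (simp add: Fract_eq_iff)
  qed
  show thesis
  proof (rule that[of E])
    show "E (Fract x 1) = Fract (D x) 1" for x
      by (simp add: E derivation_1[OF D])
    show "derivation E"
      unfolding derivation_def
    proof (intro conjI allI)
      fix x y :: "'a fract"
      obtain a b c d where x: "x = Fract a b" "b \<noteq> 0" and y: "y = Fract c d" "d \<noteq> 0"
        by (metis Fract_cases)
      show "E (x + y) = E x + E y" "E (x * y) = E x * y + x * E y"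
        using x y
        by (auto simp: E Fract_eq_iff derivation_add[OF D] derivation_mult[OF D] algebra_simps)
    qed
  qed
qed

lemma mem_localization:
  "x \<in> localization (R - {0}) A \<longleftrightarrow> (\<exists>a\<in>A. \<exists>s\<in>R. s \<noteq> 0 \<and> x = Fract a s)"
  by (auto simp: localization_def)

lemma mem_Frac: "x \<in> Frac A \<longleftrightarrow> (\<exists>a\<in>A. \<exists>s\<in>A. s \<noteq> 0 \<and> x = Fract a s)"
  unfolding Frac_def by (rule mem_localization)

lemma subring_of_localization:
  fixes A :: "'a::idom set"
  assumes A: "subring_of A" and R: "subring_of R" and "R \<subseteq> A"
  shows "subring_of (localization (R - {0}) A)"
  unfolding subring_of_def
proof (intro conjI ballI)
  show "1 \<in> localization (R - {0}) A"
    unfolding mem_localization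
    by (intro bexI[of _ 1]) (auto simp: One_fract_def subring_of_1 A R)
  fix x y assume "x \<in> localization (R - {0}) A" "y \<in> localization (R - {0}) A"
  then obtain a s b r where x: "a \<in> A" "s \<in> R" "s \<noteq> 0" "x = Fract a s"
    and y: "b \<in> A" "r \<in> R" "r \<noteq> 0" "y = Fract b r"
    unfolding mem_localization by blast
  have "s \<in> A" "r \<in> A" using x y \<open>R \<subseteq> A\<close> by auto
  have "x - y = Fract (a * r - b * s) (s * r)" "x * y = Fract (a * b) (s * r)"
    using x y by (simp_all add: algebra_simps)
  moreover have "a * r - b * s \<in> A" "a * b \<in> A"
    using x y \<open>s \<in> A\<close> \<open>r \<in> A\<close> A by (auto intro!: subring_of_diff subring_of_mult)
  moreover have "s * r \<in> R" "s * r \<noteq> 0"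
    using x y R by (auto intro: subring_of_mult)
  ultimately show "x - y \<in> localization (R - {0}) A" "x * y \<in> localization (R - {0}) A"
    unfolding mem_localization by blast+
qed

lemma Fract_1_in_localization: "subring_of R \<Longrightarrow> a \<in> A \<Longrightarrow> Fract a 1 \<in> localization (R - {0}) A"
  for A :: "'a::idom set"
  unfolding mem_localization by (intro bexI[of _ a] bexI[of _ 1]) (auto simp: subring_of_1)

lemma Frac_subset_localization: "R \<subseteq> A \<Longrightarrow> Frac R \<subseteq> localization (R - {0}) A"
  unfolding Frac_def localization_def by blast

lemma localization_subset_Frac: "R \<subseteq> A \<Longrightarrow> localization (R - {0}) A \<subseteq> Frac A"
  unfolding Frac_def localization_def by blast

lemma Frac_mono: "R \<subseteq> A \<Longrightarrow> Frac R \<subseteq> Frac A"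
  using Frac_subset_localization localization_subset_Frac by blast

lemma subfield_of_Frac:
  fixes A :: "'a::idom set"
  assumes A: "subring_of A"
  shows "subfield_of (Frac A)"
  unfolding subfield_of_def
proof (intro conjI ballI)
  show *: "subring_of (Frac A)"
    unfolding Frac_def by (intro subring_of_localization A order.refl)
  fix x assume "x \<in> Frac A"
  then obtain a s where x: "a \<in> A" "s \<in> A" "s \<noteq> 0" "x = Fract a s"
    unfolding mem_Frac by blast
  show "inverse x \<in> Frac A"
  proof (cases "a = 0")
    case True
    then have "x = 0" using x by (simp add: Zero_fract_def Fract_eq_iff)
    then show ?thesis by (simp add: subring_of_0[OF *])
  next
    case False
    have "inverse x = Fract s a" using x by simp
    with False x show ?thesis unfolding mem_Frac by blast
  qed
qed

lemma poly_Fract: "poly (map_poly (\<lambda>c. Fract c 1) H) (Fract p 1) = Fract (poly H p) 1"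
  for H :: "'a::idom poly"
  by (induction H) (simp_all add: map_poly_pCons Zero_fract_def)

lemma derivation_vanishes_on_Frac:
  fixes E :: "'a::idom fract \<Rightarrow> 'a fract"
  assumes E: "derivation E" "\<And>r. r \<in> R \<Longrightarrow> E (Fract r 1) = 0" and "x \<in> Frac R"
  shows "E x = 0"
proof -
  obtain r s where x: "r \<in> R" "s \<in> R" "s \<noteq> 0" "x = Fract r s"
    using \<open>x \<in> Frac R\<close> unfolding mem_Frac by blast
  have "x * Fract s 1 = Fract r 1"
    using x by (simp add: Fract_eq_iff)
  then have "E (x * Fract s 1) = 0"
    using E(2)[OF x(1)] by simp
  then have "E x * Fract s 1 = 0"
    using E(2)[OF x(2)] unfolding derivation_mult[OF E(1)] by simp
  moreover have "Fract s 1 \<noteq> 0"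
    using x(3) by (simp add: Fract_1_eq_0_iff)
  ultimately show ?thesis
    by (metis mult_eq_0_iff)
qed

section \<open>Locally nilpotent derivations and their kernels\<close>

lemma LND_derivation: "D \<in> LND \<Longrightarrow> derivation D"
  by (simp add: LND_def)

lemma funpow_derivation_0: "derivation D \<Longrightarrow> (D ^^ n) 0 = 0"
  by (induction n) (simp_all add: derivation_0)

lemma funpow_derivation_add: "derivation D \<Longrightarrow> (D ^^ n) (x + y) = (D ^^ n) x + (D ^^ n) y"
  by (induction n) (simp_all add: derivation_add)

lemma funpow_derivation_const_mult:
  "derivation D \<Longrightarrow> D r = 0 \<Longrightarrow> (D ^^ n) (r * x) = r * (D ^^ n) x"
  by (induction n) (simp_all add: derivation_mult)

lemma funpow_derivation_eq_0_mono:
  assumes "derivation D" "(D ^^ m) x = 0" "m \<le> n"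
  shows "(D ^^ n) x = 0"
proof -
  have "(D ^^ n) x = (D ^^ (n - m)) ((D ^^ m) x)"
    using assms(3) by (metis comp_apply funpow_add le_add_diff_inverse2)
  then show ?thesis by (simp add: assms funpow_derivation_0)
qed

text \<open>The only surviving term of the general Leibniz rule.\<close>

lemma funpow_derivation_mult_top:
  assumes D: "derivation D"
  shows "(D ^^ Suc m) x = 0 \<Longrightarrow> (D ^^ Suc n) y = 0 \<Longrightarrow>
    (D ^^ (m + n)) (x * y) = of_nat ((m + n) choose m) * ((D ^^ m) x * (D ^^ n) y)"
proof (induction "m + n" arbitrary: m n x y)
  case 0
  then show ?case by simp
next
  case (Suc k)
  show ?case
  proof (cases "m = 0 \<or> n = 0")
    case True
    then show ?thesis
    proof
      assume "m = 0"
      with Suc.prems show ?thesis by (simp add: funpow_derivation_const_mult[OF D])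
    next
      assume "n = 0"
      with Suc.prems show ?thesis
        using funpow_derivation_const_mult[OF D, of y m x] by (simp add: mult.commute)
    qed
  next
    case False
    then obtain m' n' where mn: "m = Suc m'" "n = Suc n'"
      by (metis not0_implies_Suc)
    have shift: "(D ^^ m') (D x) = (D ^^ m) x" "(D ^^ n') (D y) = (D ^^ n) y"
      by (simp_all add: mn funpow_swap1)
    have nil: "(D ^^ Suc m') (D x) = 0" "(D ^^ Suc n') (D y) = 0"
      using Suc.prems by (simp_all add: mn funpow_swap1)
    have k: "k = m' + n" "k = m + n'"
      using Suc.hyps(2) mn by simp_all
    have "(D ^^ (m + n)) (x * y) = (D ^^ k) (D (x * y))"
      unfolding Suc.hyps(2)[symmetric] by (simp add: funpow_swap1)
    also have "\<dots> = (D ^^ k) (D x * y) + (D ^^ k) (x * D y)"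
      by (simp only: derivation_mult[OF D] funpow_derivation_add[OF D])
    also have "(D ^^ k) (D x * y) = of_nat (k choose m') * ((D ^^ m) x * (D ^^ n) y)"
      using Suc.hyps(1)[OF k(1) nil(1) Suc.prems(2)] unfolding shift k(1)[symmetric] .
    also have "(D ^^ k) (x * D y) = of_nat (k choose m) * ((D ^^ m) x * (D ^^ n) y)"
      using Suc.hyps(1)[OF k(2) Suc.prems(1) nil(2)] unfolding shift k(2)[symmetric] .
    also have "of_nat (k choose m') * c + of_nat (k choose m) * c = of_nat (m + n choose m) * c"
      for c :: 'a
      unfolding Suc.hyps(2)[symmetric] by (simp add: mn algebra_simps)
    finally show ?thesis .
  qed
qed

text \<open>
  For nonzero \<open>x\<close> this exceeds by one the degree of \<open>x\<close> with respect to \<open>D\<close>; at \<open>0\<close> it is \<open>0\<close>,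
  so that applying \<open>D\<close> always lowers it by one as long as it is positive.
\<close>

definition nil_index :: "('b::comm_ring_1 \<Rightarrow> 'b) \<Rightarrow> 'b \<Rightarrow> nat" where
  "nil_index D x = (LEAST n. (D ^^ n) x = 0)"

lemma funpow_nil_index: "D \<in> LND \<Longrightarrow> (D ^^ nil_index D x) x = 0"
  unfolding nil_index_def by (rule LeastI_ex) (simp add: LND_def)

lemma nil_index_le: "(D ^^ n) x = 0 \<Longrightarrow> nil_index D x \<le> n"
  unfolding nil_index_def by (rule Least_le)

lemma nil_index_derivation:
  assumes "D \<in> LND" "x \<noteq> 0"
  shows "nil_index D x = Suc (nil_index D (D x))"
proof -
  obtain n where "(D ^^ n) x = 0" using assms by (auto simp: LND_def)
  then have "(LEAST n. (D ^^ n) x = 0) = Suc (LEAST n. (D ^^ Suc n) x = 0)"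
    by (rule Least_Suc) (use assms in simp)
  then show ?thesis
    by (simp add: nil_index_def funpow_Suc_right del: funpow.simps)
qed

text \<open>
  Degrees with respect to \<open>D\<close> add up in products, because the surviving Leibniz term is a
  product of nonzero factors in a domain of characteristic zero.  Hence a divisor of a nonzero
  element has no larger degree.
\<close>

lemma nil_index_mult:
  fixes x y :: "'b::idom"
  assumes char: "CHAR('b) = 0" and D: "D \<in> LND" and "x * y \<noteq> 0"
  shows "nil_index D x \<le> nil_index D (x * y)"
proof -
  note der = LND_derivation[OF D]
  have nz: "x \<noteq> 0" "y \<noteq> 0" using assms by auto
  define m where "m = nil_index D (D x)"
  define n where "n = nil_index D (D y)"
  have m: "nil_index D x = Suc m" and n: "nil_index D y = Suc n"
    using nil_index_derivation[OF D] nz by (simp_all add: m_def n_def)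
  have "(D ^^ m) x \<noteq> 0" "(D ^^ n) y \<noteq> 0"
    using nil_index_le[of m D x] nil_index_le[of n D y] m n by auto
  moreover have "of_nat ((m + n) choose m) \<noteq> (0::'b)"
    by (intro of_nat_nonzero_if_CHAR_0 char zero_less_binomial) simp
  ultimately have "(D ^^ (m + n)) (x * y) \<noteq> 0"
    using funpow_derivation_mult_top[OF der, of m x n y] funpow_nil_index[OF D, of x]
      funpow_nil_index[OF D, of y] m n by simp
  then have "\<not> nil_index D (x * y) \<le> m + n"
    using funpow_derivation_eq_0_mono[OF der funpow_nil_index[OF D]] by blast
  then show ?thesis using m by simp
qed

lemma nil_index_const_mult:
  assumes D: "D \<in> LND" and "D r = 0"
  shows "nil_index D (r * x) \<le> nil_index D x"
  by (intro nil_index_le)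
    (simp add: funpow_derivation_const_mult[OF LND_derivation[OF D]] assms funpow_nil_index)

text \<open>
  The nonzero elements of the kernel are those of degree zero, and a factor has no larger degree.
\<close>

lemma LND_kernel_factor:
  fixes x y :: "'b::idom"
  assumes char: "CHAR('b) = 0" and D: "D \<in> LND" and "x * y \<noteq> 0" "D (x * y) = 0"
  shows "D x = 0"
proof -
  have "nil_index D (x * y) \<le> 1"
    by (rule nil_index_le) (simp add: assms)
  then have "nil_index D x \<le> 1"
    using nil_index_mult[OF char D assms(3)] by simp
  then have "(D ^^ 1) x = 0"
    using funpow_derivation_eq_0_mono[OF LND_derivation[OF D] funpow_nil_index[OF D]] by blast
  then show ?thesis by simp
qed

lemma mem_common_kernel: "x \<in> common_kernel \<Delta> \<longleftrightarrow> (\<forall>D\<in>\<Delta>. D x = 0)"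
  by (auto simp: common_kernel_def)

lemma kernel_rings_subring:
  assumes "A \<in> kernel_rings"
  shows "subring_of A"
proof -
  obtain \<Delta> where "\<Delta> \<subseteq> LND" and A: "A = common_kernel \<Delta>"
    using assms by (auto simp: kernel_rings_def)
  then have D: "derivation D" if "D \<in> \<Delta>" for D
    using that LND_derivation by blast
  show ?thesis
    unfolding A subring_of_def mem_common_kernel
  proof (intro conjI ballI)
    fix x y D assume "x \<in> common_kernel \<Delta>" "y \<in> common_kernel \<Delta>" and "D \<in> \<Delta>"
    then have "D x = 0" "D y = 0" by (auto simp: mem_common_kernel)
    then show "D (x - y) = 0" "D (x * y) = 0"
      unfolding derivation_diff[OF D[OF \<open>D \<in> \<Delta>\<close>]] derivation_mult[OF D[OF \<open>D \<in> \<Delta>\<close>]]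
      by simp_all
  qed (rule derivation_1[OF D])
qed

text \<open>
  Kernel rings are factorially closed, so prime factors of their elements taken in the whole ring
  stay inside.  This lets the arithmetic of the ambient factorial ring act on every ring of the chain.
\<close>

lemma kernel_rings_factor:
  fixes x y :: "'b::idom"
  assumes "CHAR('b) = 0" "A \<in> kernel_rings" "x * y \<in> A" "x * y \<noteq> 0"
  shows "x \<in> A"
proof -
  obtain \<Delta> where "\<Delta> \<subseteq> LND" and A: "A = common_kernel \<Delta>"
    using assms by (auto simp: kernel_rings_def)
  then have "D x = 0" if "D \<in> \<Delta>" for D
    using LND_kernel_factor[OF assms(1) _ assms(4), of D] assms(3) that
    by (auto simp: mem_common_kernel)
  then show ?thesis by (simp add: A mem_common_kernel)
qed

lemma kernel_rings_algebraic:
  fixes x :: "'b::idom"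
  assumes "CHAR('b) = 0" "A \<in> kernel_rings" "algebraic_over A x"
  shows "x \<in> A"
proof -
  obtain \<Delta> where \<Delta>: "\<Delta> \<subseteq> LND" and A: "A = common_kernel \<Delta>"
    using assms by (auto simp: kernel_rings_def)
  have "D x = 0" if "D \<in> \<Delta>" for D
    using derivation_algebraic_eq_0[OF assms(1) kernel_rings_subring[OF assms(2)] assms(3), of D]
      that \<Delta> LND_derivation by (auto simp: A mem_common_kernel)
  then show ?thesis by (simp add: A mem_common_kernel)
qed


section \<open>One step of transcendence degree one\<close>

text \<open>
  If \<open>A\<close> has transcendence degree one over \<open>R\<close>, derivations that vanish on \<open>R\<close> are determined on
  \<open>A\<close> by their value at a single transcendental \<open>z\<close>, hence by their value at any \<open>p\<close> where
  one of them does not vanish.  Since \<open>u\<close> and \<open>w\<close> do not depend on \<open>E\<close>, information can be carried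
  from one derivation to another, without exchange arguments between transcendence bases.
\<close>

lemma derivations_proportional_on_trdeg_1:
  fixes A R :: "'a::idom set"
  assumes char: "CHAR('a) = 0" and A: "subring_of A" and R: "subring_of R" and "R \<subseteq> A"
    and trdeg: "has_trdeg A R 1" and "p \<in> A" "a \<in> A"
    and D: "derivation D" "\<And>r. r \<in> R \<Longrightarrow> D r = 0" "D p \<noteq> 0"
  obtains u w where "u \<in> A" "w \<in> A" "u \<noteq> 0"
    and "\<And>E. derivation E \<Longrightarrow> (\<And>r. r \<in> R \<Longrightarrow> E r = 0) \<Longrightarrow> u * E a = w * E p"
proof -
  obtain X where X: "transcendence_basis (Frac R) (Frac A) X" "card X = 1"
    using trdeg by (auto simp: has_trdeg_def)
  then obtain z where "X = {z}" by (auto simp: card_1_singleton_iff)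
  have "z \<in> Frac A"
    using X \<open>X = {z}\<close> by (auto simp: transcendence_basis_def)
  have alg: "algebraic_over (adjoin (Frac R) {z}) y" if "y \<in> Frac A" for y
    using that X \<open>X = {z}\<close> by (auto simp: transcendence_basis_def)
  have incl: "Fract x 1 \<in> Frac A" if "x \<in> A" for x
    unfolding Frac_def using Fract_1_in_localization[OF A that] .
  note slope = derivations_proportional[OF CHAR_fract[OF char] subfield_of_Frac[OF A]
      Frac_mono[OF \<open>R \<subseteq> A\<close>] \<open>z \<in> Frac A\<close> incl alg[OF incl]]
  obtain f where f: "f \<in> Frac A"
    "\<And>E. derivation E \<Longrightarrow> (\<And>k. k \<in> Frac R \<Longrightarrow> E k = 0) \<Longrightarrow> E (Fract a 1) = f * E z"
    using slope[OF \<open>a \<in> A\<close> \<open>a \<in> A\<close>] by blast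
  obtain g where g: "g \<in> Frac A"
    "\<And>E. derivation E \<Longrightarrow> (\<And>k. k \<in> Frac R \<Longrightarrow> E k = 0) \<Longrightarrow> E (Fract p 1) = g * E z"
    using slope[OF \<open>p \<in> A\<close> \<open>p \<in> A\<close>] by blast
  have ext: "\<exists>E'. derivation E' \<and> (\<forall>x. E' (Fract x 1) = Fract (E x) 1) \<and> (\<forall>k\<in>Frac R. E' k = 0)"
    if E: "derivation E" "\<And>r. r \<in> R \<Longrightarrow> E r = 0" for E
  proof -
    obtain E' where E': "derivation E'" "\<And>x. E' (Fract x 1) = Fract (E x) 1"
      using derivation_extends_to_fract[OF E(1)] by blast
    then show ?thesis
      using derivation_vanishes_on_Frac[of E' R] E(2) by (metis Fract_1_eq_0_iff)
  qed
  have "g \<noteq> 0"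
    using ext[OF D(1,2)] g(2) D(3) by (metis Fract_1_eq_0_iff mult_zero_left)
  have "f / g \<in> Frac A"
    using f g by (intro subfield_of_divide subfield_of_Frac A)
  then obtain w u where wu: "w \<in> A" "u \<in> A" "u \<noteq> 0" "f / g = Fract w u"
    unfolding mem_Frac by blast
  show thesis
  proof (rule that[OF wu(2,1,3)])
    fix E assume E: "derivation E" "\<And>r. r \<in> R \<Longrightarrow> E r = 0"
    obtain E' where E': "derivation E'" "\<And>x. E' (Fract x 1) = Fract (E x) 1"
      "\<And>k. k \<in> Frac R \<Longrightarrow> E' k = 0"
      using ext[OF E] by blast
    have "Fract (E a) 1 = f * E' z" "Fract (E p) 1 = g * E' z"
      using f(2)[OF E'(1,3)] g(2)[OF E'(1,3)] E'(2) by simp_all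
    then have "Fract (E a) 1 = (f / g) * Fract (E p) 1"
      using \<open>g \<noteq> 0\<close> by simp
    then show "u * E a = w * E p"
      using wu by (simp add: Fract_eq_iff mult.commute)
  qed
qed

text \<open>
  The bound on \<open>D p\<close> holds if \<open>p\<close> has the least degree among the elements of \<open>A\<close> outside \<open>R\<close>.
  A prime factor \<open>q\<close> of \<open>u\<close> lies in \<open>A\<close>; if it is not in \<open>R\<close>, it cannot divide the nonzero
  element \<open>D p\<close>, whose degree is smaller.  Therefore \<open>q\<close> divides \<open>w\<close> and cancels, until only
  factors in \<open>R\<close> are left on the left-hand side.
\<close>

lemma clear_slope_denominator:
  fixes A R :: "'b::{idom, factorial_semiring} set"
  assumes char: "CHAR('b) = 0" and D: "D \<in> LND"
    and A: "subring_of A" "\<And>x y. x * y \<in> A \<Longrightarrow> x * y \<noteq> 0 \<Longrightarrow> x \<in> A"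
    and R: "subring_of R" "\<And>x y. x * y \<in> R \<Longrightarrow> x * y \<noteq> 0 \<Longrightarrow> x \<in> R"
    and "D p \<noteq> 0" and min: "\<And>q. q \<in> A \<Longrightarrow> q \<notin> R \<Longrightarrow> nil_index D (D p) < nil_index D q"
  shows "u \<in> A \<Longrightarrow> u \<noteq> 0 \<Longrightarrow> w \<in> A \<Longrightarrow> u * x = w * D p \<Longrightarrow>
    \<exists>r\<in>R. r \<noteq> 0 \<and> (\<exists>v\<in>A. r * x = v * D p)"
proof (induction u arbitrary: x w rule: prime_divisors_induct)
  case zero
  then show ?case by simp
next
  case (unit u)
  then obtain v where "1 = u * v" by (auto elim: dvdE)
  then have "u \<in> R"
    using R(2)[of u v] subring_of_1[OF R(1)] by simp
  with unit show ?case by blast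
next
  case (factor q u)
  have nz: "q \<noteq> 0" "u \<noteq> 0" using factor.prems by auto
  have "q \<in> A" "u \<in> A"
    using A(2)[of q u] A(2)[of u q] factor.prems by (simp_all add: mult.commute)
  show ?case
  proof (cases "q \<in> R")
    case True
    have "u * (q * x) = w * D p"
      using factor.prems by (simp add: algebra_simps)
    with factor.IH[OF \<open>u \<in> A\<close> nz(2) factor.prems(3)] obtain r v
      where rv: "r \<in> R" "r \<noteq> 0" "v \<in> A" "r * (q * x) = v * D p" by blast
    have "r * q \<in> R" "r * q \<noteq> 0" "r * q * x = v * D p"
      using rv True nz R(1) by (simp_all add: subring_of_mult mult.assoc)
    with rv show ?thesis by blast
  next
    case False
    have "\<not> q dvd D p"
    proof
      assume "q dvd D p"
      then obtain y where "D p = q * y" by (elim dvdE)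
      then have "nil_index D q \<le> nil_index D (D p)"
        using nil_index_mult[OF char D, of q y] \<open>D p \<noteq> 0\<close> by simp
      with min[OF \<open>q \<in> A\<close> False] show False by simp
    qed
    moreover have "q dvd w * D p"
      using factor.prems(4) by (metis dvd_triv_left mult.assoc)
    ultimately have "q dvd w"
      using prime_dvd_mult_iff[OF factor.hyps] by blast
    then obtain w' where w': "w = q * w'" by (elim dvdE)
    have "w' \<in> A"
    proof (cases "w = 0")
      case True
      then show ?thesis using w' nz by (simp add: subring_of_0[OF A(1)])
    next
      case False
      then show ?thesis
        using A(2)[of w' q] w' factor.prems(3) by (simp add: mult.commute)
    qed
    moreover have "u * x = w' * D p"
    proof -
      have "q * (u * x) = q * (w' * D p)"
        using factor.prems(4) w' by (simp add: mult.assoc)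
      then show ?thesis using nz by simp
    qed
    ultimately show ?thesis
      using factor.IH[OF \<open>u \<in> A\<close> nz(2)] by blast
  qed
qed

text \<open>
  Integration divides by the integers up to \<open>degree h + 1\<close>, which need not be units in \<open>R\<close>; the
  factorial of \<open>degree h + 1\<close> serves as a common multiple \<open>N\<close>.
\<close>

lemma polys_over_antiderivative:
  fixes h :: "'b::idom poly"
  assumes R: "subring_of R" and h: "h \<in> polys_over R"
  obtains N H where "N > 0" "H \<in> polys_over R" "pderiv H = smult (of_nat N) h"
proof -
  define N :: nat where "N = fact (Suc (degree h))"
  define H where "H = pCons 0 (\<Sum>i\<le>degree h. monom (of_nat (N div Suc i) * coeff h i) i)"
  have coeff_H: "coeff H (Suc i) = of_nat (N div Suc i) * coeff h i" for i
  proof (cases "i \<le> degree h")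
    case True
    then show ?thesis by (simp add: H_def coeff_sum)
  next
    case False
    then show ?thesis by (simp add: H_def coeff_sum coeff_eq_0)
  qed
  show thesis
  proof (rule that)
    show "N > 0" by (simp add: N_def)
    have "coeff H 0 = 0" by (simp add: H_def)
    then have "coeff H i \<in> R" for i
      using h R
      by (cases i) (simp_all add: coeff_H polys_over_def subring_of_0 subring_of_mult
          subring_of_of_nat)
    then show "H \<in> polys_over R" by (simp add: polys_over_def)
    show "pderiv H = smult (of_nat N) h"
    proof (rule poly_eqI)
      fix i
      show "coeff (pderiv H) i = coeff (smult (of_nat N) h) i"
      proof (cases "i \<le> degree h")
        case True
        then have "Suc i dvd N" unfolding N_def by (intro dvd_fact) auto
        then have "Suc i * (N div Suc i) = N" by (rule dvd_mult_div_cancel)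
        then have "of_nat (Suc i) * of_nat (N div Suc i) = (of_nat N :: 'b)"
          by (metis of_nat_mult)
        then show ?thesis
          by (simp add: coeff_pderiv coeff_H mult.assoc[symmetric] del: of_nat_Suc)
      qed (simp add: coeff_pderiv coeff_H coeff_eq_0)
    qed
  qed
qed

text \<open>
  The relation \<open>r * D a = v * D p\<close> says that \<open>v / r\<close> is the derivative of \<open>a\<close> with respect to \<open>p\<close>.
  Its degree is smaller than that of \<open>a\<close>, so by induction it is a polynomial in \<open>p\<close> up to a
  denominator in \<open>R\<close>.  Integrating this polynomial recovers \<open>a\<close> up to an element killed by
  \<open>D\<close>, that is, a constant of integration in \<open>R\<close>.
\<close>

lemma slope_descent:
  fixes A R :: "'b::idom set"
  assumes char: "CHAR('b) = 0" and D: "D \<in> LND"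
    and A: "subring_of A" and R: "subring_of R" "R \<subseteq> A" "\<And>r. r \<in> R \<Longrightarrow> D r = 0"
    and ker: "\<And>a. a \<in> A \<Longrightarrow> D a = 0 \<Longrightarrow> a \<in> R"
    and "p \<in> A"
    and slope: "\<And>a. a \<in> A \<Longrightarrow> \<exists>r\<in>R. r \<noteq> 0 \<and> (\<exists>v\<in>A. r * D a = v * D p)"
  shows "a \<in> A \<Longrightarrow> \<exists>r\<in>R. r \<noteq> 0 \<and> (\<exists>H\<in>polys_over R. r * a = poly H p)"
proof (induction "nil_index D a" arbitrary: a rule: less_induct)
  case less
  note der = LND_derivation[OF D]
  have const: "D (r * y) = r * D y" if "r \<in> R" for r y
    using R(3)[OF that] by (simp add: derivation_mult[OF der])
  show ?case
  proof (cases "D a = 0")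
    case True
    with ker[OF less.prems] have "[:a:] \<in> polys_over R"
      by (simp add: polys_over_pCons) (simp add: polys_over_def subring_of_0[OF R(1)])
    then show ?thesis
      by (intro bexI[of _ 1] conjI bexI[of _ "[:a:]"]) (simp_all add: subring_of_1[OF R(1)])
  next
    case False
    obtain r v where rv: "r \<in> R" "r \<noteq> 0" "v \<in> A" "r * D a = v * D p"
      using slope[OF less.prems] by blast
    have "a \<noteq> 0" using False derivation_0[OF der] by auto
    have "nil_index D v \<le> nil_index D (v * D p)"
      using rv False by (intro nil_index_mult[OF char D]) (metis mult_eq_0_iff)
    also have "\<dots> \<le> nil_index D (D a)"
      using nil_index_const_mult[OF D R(3)[OF rv(1)], of "D a"] rv(4) by simp
    also have "\<dots> < nil_index D a"
      using nil_index_derivation[OF D \<open>a \<noteq> 0\<close>] by simp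
    finally obtain s h where sh: "s \<in> R" "s \<noteq> 0" "h \<in> polys_over R" "s * v = poly h p"
      using less.hyps[OF _ \<open>v \<in> A\<close>] by blast
    obtain N H where N: "N > 0" and H: "H \<in> polys_over R" "pderiv H = smult (of_nat N) h"
      using polys_over_antiderivative[OF R(1) sh(3)] .
    define m where "m = of_nat N * s * r"
    have m: "m \<in> R" "m \<noteq> 0"
      using rv sh of_nat_nonzero_if_CHAR_0[OF char N] R(1)
      by (auto simp: m_def intro!: subring_of_mult subring_of_of_nat)
    define c where "c = m * a - poly H p"
    have "D (poly H p) = of_nat N * (s * v) * D p"
      using derivation_poly_const[OF der H(1) R(3), of p] by (simp add: H(2) sh(4))
    also have "\<dots> = of_nat N * s * (r * D a)"
      by (simp add: rv(4) mult.assoc)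
    also have "\<dots> = D (m * a)"
      unfolding const[OF m(1)] by (simp add: m_def mult.assoc)
    finally have "D c = 0"
      by (simp add: c_def derivation_diff[OF der])
    moreover have "c \<in> A"
      unfolding c_def using m(1) R(2) less.prems A \<open>p \<in> A\<close> polys_over_mono[OF R(2) H(1)]
      by (intro subring_of_diff subring_of_mult poly_in_subring) auto
    ultimately have "c \<in> R" using ker by blast
    then have "[:c:] \<in> polys_over R"
      by (simp add: polys_over_pCons) (simp add: polys_over_def subring_of_0[OF R(1)])
    then have "H + [:c:] \<in> polys_over R"
      by (intro polys_over_add R(1) H(1))
    moreover have "m * a = poly (H + [:c:]) p"
      by (simp add: c_def)
    ultimately show ?thesis using m by blast
  qed
qed

text \<open>
  The derivation \<open>D\<close> is one of those defining \<open>R\<close>, chosen not to vanish on \<open>A\<close>.  Its kernel meets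
  \<open>A\<close> exactly in \<open>R\<close>, although further derivations may be needed to cut \<open>R\<close> out of the whole ring:
  by proportionality, an element of \<open>A\<close> killed by \<open>D\<close> is killed by all of them.  The image in
  the fraction field of an element \<open>p\<close> of least degree in \<open>A - R\<close> is then the variable \<open>t\<close>.
\<close>

lemma kernel_rings_trdeg_1_in_A1_star:
  fixes A R :: "'b::{idom, factorial_semiring} set"
  assumes char: "CHAR('b) = 0" and A: "A \<in> kernel_rings" and R: "R \<in> kernel_rings"
    and "R \<subset> A" and trdeg: "has_trdeg A R 1"
  shows "R \<in> A1_star A"
proof -
  have RA: "R \<subseteq> A" using \<open>R \<subset> A\<close> by blast
  note Asub = kernel_rings_subring[OF A] and Rsub = kernel_rings_subring[OF R]
  obtain \<Delta> where \<Delta>: "\<Delta> \<subseteq> LND" and R_eq: "R = common_kernel \<Delta>"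
    using R by (auto simp: kernel_rings_def)
  obtain a0 where a0: "a0 \<in> A" "a0 \<notin> R" using \<open>R \<subset> A\<close> by blast
  then obtain D where "D \<in> \<Delta>" and Da0: "D a0 \<noteq> 0"
    by (auto simp: R_eq mem_common_kernel)
  then have D: "D \<in> LND" using \<Delta> by blast
  note der = LND_derivation[OF D]
  have vanish: "E r = 0" if "E \<in> \<Delta>" "r \<in> R" for E r
    using that by (auto simp: R_eq mem_common_kernel)
  note van = vanish[OF \<open>D \<in> \<Delta>\<close>]
  have slope: "\<exists>u\<in>A. \<exists>w\<in>A. u \<noteq> 0 \<and>
      (\<forall>E. derivation E \<longrightarrow> (\<forall>r\<in>R. E r = 0) \<longrightarrow> u * E a = w * E b)"
    if "a \<in> A" "b \<in> A" "D b \<noteq> 0" for a b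
    by (rule derivations_proportional_on_trdeg_1
        [OF char Asub Rsub RA trdeg that(2,1) der van that(3)]) blast+

  have ker: "a \<in> R" if "a \<in> A" "D a = 0" for a
  proof -
    obtain u w where "u \<noteq> 0"
      and uw: "\<And>E. derivation E \<Longrightarrow> \<forall>r\<in>R. E r = 0 \<Longrightarrow> u * E a = w * E a0"
      using slope[OF \<open>a \<in> A\<close> a0(1) Da0] by blast
    have "w = 0"
      using uw[OF der] van \<open>D a = 0\<close> Da0 by simp
    have "E a = 0" if "E \<in> \<Delta>" for E
    proof -
      have "derivation E" "\<forall>r\<in>R. E r = 0"
        using that \<Delta> LND_derivation vanish by blast+
      then show ?thesis
        using uw[of E] \<open>w = 0\<close> \<open>u \<noteq> 0\<close> by simp
    qed
    then show ?thesis by (simp add: R_eq mem_common_kernel)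
  qed

  obtain p where p: "p \<in> A" "p \<notin> R"
    and p_min: "\<And>q. q \<in> A \<Longrightarrow> q \<notin> R \<Longrightarrow> nil_index D p \<le> nil_index D q"
    using ex_has_least_nat[of "\<lambda>q. q \<in> A \<and> q \<notin> R" a0 "nil_index D"] a0 by blast
  have Dp: "D p \<noteq> 0" using ker p by blast
  have "p \<noteq> 0" using Dp derivation_0[OF der] by auto
  have below: "nil_index D (D p) < nil_index D q" if "q \<in> A" "q \<notin> R" for q
    using p_min[OF that] nil_index_derivation[OF D \<open>p \<noteq> 0\<close>] by simp
  have R_slope: "\<exists>r\<in>R. r \<noteq> 0 \<and> (\<exists>v\<in>A. r * D a = v * D p)" if a: "a \<in> A" for a
  proof -
    obtain u w where uw: "u \<in> A" "u \<noteq> 0" "w \<in> A" "u * D a = w * D p"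
      using slope[OF a p(1) Dp] der van by metis
    show ?thesis
      by (rule clear_slope_denominator[OF char D Asub kernel_rings_factor[OF char A] Rsub
          kernel_rings_factor[OF char R] Dp below uw])
  qed
  have poly_mult: "\<exists>r\<in>R. r \<noteq> 0 \<and> (\<exists>H\<in>polys_over R. r * a = poly H p)" if "a \<in> A" for a
    by (rule slope_descent[OF char D Asub Rsub RA van ker p(1) R_slope that])

  define t where "t = Fract p 1"
  have "\<not> algebraic_over (Frac R) t"
  proof
    assume alg: "algebraic_over (Frac R) t"
    obtain E where E: "derivation E" "\<And>x. E (Fract x 1) = Fract (D x) 1"
      using derivation_extends_to_fract[OF der] by blast
    have "E r = 0" if "r \<in> Frac R" for r
      by (rule derivation_vanishes_on_Frac[OF E(1) _ that])
        (simp add: E(2) van Zero_fract_def)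
    then have "E t = 0"
      by (intro derivation_algebraic_eq_0[OF CHAR_fract[OF char]
            subfield_of_subring[OF subfield_of_Frac[OF Rsub]] alg E(1)])
    then show False using Dp by (simp add: t_def E(2) Fract_1_eq_0_iff)
  qed
  moreover have "localization (R - {0}) A = (\<lambda>P. poly P t) ` polys_over (Frac R)"
  proof (intro equalityI subsetI)
    fix x assume "x \<in> localization (R - {0}) A"
    then obtain a s where x: "a \<in> A" "s \<in> R" "s \<noteq> 0" "x = Fract a s"
      unfolding mem_localization by blast
    obtain r H where H: "r \<in> R" "r \<noteq> 0" "H \<in> polys_over R" "r * a = poly H p"
      using poly_mult[OF x(1)] by blast
    define P where "P = smult (Fract 1 (r * s)) (map_poly (\<lambda>c. Fract c 1) H)"
    have rs: "r * s \<in> R" "r * s \<noteq> 0"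
      using x H by (auto intro: subring_of_mult[OF Rsub])
    have "Fract c (r * s) \<in> Frac R" if "c \<in> R" for c
      unfolding mem_Frac using rs that by blast
    then have "P \<in> polys_over (Frac R)"
      using H(3) by (simp add: P_def polys_over_def coeff_map_poly Zero_fract_def)
    moreover have "x = poly P t"
    proof -
      have "poly P t = Fract 1 (r * s) * Fract (r * a) 1"
        by (simp add: P_def t_def poly_Fract H(4))
      then show ?thesis
        using x rs by (simp add: Fract_eq_iff)
    qed
    ultimately show "x \<in> (\<lambda>P. poly P t) ` polys_over (Frac R)" by blast
  next
    fix x assume "x \<in> (\<lambda>P. poly P t) ` polys_over (Frac R)"
    then obtain P where "P \<in> polys_over (Frac R)" "x = poly P t" by blast
    then show "x \<in> localization (R - {0}) A"
      using polys_over_mono[OF Frac_subset_localization[OF RA], of P]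
        Fract_1_in_localization[OF Rsub p(1)]
      by (simp add: t_def poly_in_subring[OF subring_of_localization[OF Asub Rsub RA]])
  qed
  ultimately have "polynomial_ring_in_one_variable (Frac R) (localization (R - {0}) A)"
    unfolding polynomial_ring_in_one_variable_def by blast
  then show ?thesis
    using RA Rsub kernel_rings_algebraic[OF char R]
    by (auto simp: A1_star_def algebraically_closed_in_def)
qed


section \<open>Purely transcendental extensions\<close>

text \<open>
  A polynomial in the variables \<open>insert t X\<close> is regrouped as a polynomial \<open>q\<close> in \<open>t\<close> whose
  coefficients are values of polynomials in the variables \<open>X\<close>.  If it vanishes, transcendence of
  \<open>t\<close> makes every coefficient of \<open>q\<close> vanish, and independence of \<open>X\<close> then kills each group of
  monomials with a common power of \<open>t\<close>.
\<close>

lemma algebraically_independent_insert: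
  fixes K :: "'a::field set"
  assumes K: "subfield_of K" and ind: "algebraically_independent K X"
    and t: "\<not> algebraic_over (adjoin K X) t"
  shows "t \<notin> X" "algebraically_independent K (insert t X)"
proof -
  have L: "subring_of (adjoin K X)"
    by (intro subfield_of_subring subfield_of_adjoin)
  have KX: "K \<subseteq> adjoin K X" "X \<subseteq> adjoin K X"
    using adjoin_upper[of K X] by simp_all
  show "t \<notin> X"
  proof
    assume "t \<in> X"
    then have "- t \<in> adjoin K X" "1 \<in> adjoin K X" "0 \<in> adjoin K X"
      using KX L by (auto intro: subring_of_closed)
    then have "[:- t, 1:] \<in> polys_over (adjoin K X)"
      by (simp add: polys_over_pCons) (simp add: polys_over_def)
    then have "algebraic_over (adjoin K X) t"
      unfolding algebraic_over_def by (intro bexI[of _ "[:- t, 1:]"]) auto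
    with t show False by blast
  qed
  show "algebraically_independent K (insert t X)"
    unfolding algebraically_independent_def
  proof (intro ballI impI)
    fix p assume p: "p \<in> mpolys_over K (insert t X)" and eval: "eval_self p = 0"
    define mon :: "('a \<Rightarrow>\<^sub>0 nat) \<Rightarrow> 'a"
      where "mon m = (\<Prod>x\<in>Poly_Mapping.keys m. x ^ Poly_Mapping.lookup m x)" for m
    \<comment> \<open>The monomial \<open>m\<close> without its power of \<open>t\<close>.\<close>
    define rest where "rest m = m - Poly_Mapping.single t (Poly_Mapping.lookup m t)"
      for m :: "'a \<Rightarrow>\<^sub>0 nat"
    have rest: "Poly_Mapping.lookup (rest m) x = (if x = t then 0 else Poly_Mapping.lookup m x)"
      for m x
      by (simp add: rest_def lookup_minus lookup_single when_def)
    have keys_rest: "Poly_Mapping.keys (rest m) = Poly_Mapping.keys m - {t}" for m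
      by (auto simp: in_keys_iff rest split: if_splits)
    have mon_split: "mon m = mon (rest m) * t ^ Poly_Mapping.lookup m t" for m
    proof (cases "t \<in> Poly_Mapping.keys m")
      case True
      have "mon m = t ^ Poly_Mapping.lookup m t
          * (\<Prod>x\<in>Poly_Mapping.keys m - {t}. x ^ Poly_Mapping.lookup m x)"
        unfolding mon_def by (rule prod.remove) (simp_all add: True)
      also have "(\<Prod>x\<in>Poly_Mapping.keys m - {t}. x ^ Poly_Mapping.lookup m x) = mon (rest m)"
        unfolding mon_def keys_rest by (intro prod.cong) (auto simp: rest)
      finally show ?thesis by (simp add: mult.commute)
    next
      case False
      then have "Poly_Mapping.lookup m t = 0" by (simp add: in_keys_iff)
      then have "rest m = m" by (simp add: rest_def)
      with \<open>Poly_Mapping.lookup m t = 0\<close> show ?thesis by simp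
    qed
    have coeff_K: "Poly_Mapping.lookup p m \<in> K" for m
      using p by (simp add: mpolys_over_def)
    have keys_X: "Poly_Mapping.keys (rest m) \<subseteq> X" if "m \<in> Poly_Mapping.keys p" for m
      using p that by (auto simp: mpolys_over_def keys_rest)
    define q where "q = (\<Sum>m\<in>Poly_Mapping.keys p.
        monom (Poly_Mapping.lookup p m * mon (rest m)) (Poly_Mapping.lookup m t))"
    have coeff_q: "coeff q j = (\<Sum>m | m \<in> Poly_Mapping.keys p \<and> Poly_Mapping.lookup m t = j.
        Poly_Mapping.lookup p m * mon (rest m))" for j
      by (simp add: q_def coeff_sum sum.inter_filter)
    have "poly q t = (\<Sum>m\<in>Poly_Mapping.keys p. Poly_Mapping.lookup p m * mon m)"
      unfolding q_def poly_sum poly_monom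
      by (intro sum.cong refl) (subst (2) mon_split, simp)
    also have "\<dots> = 0"
      using eval by (simp add: eval_self_def mon_def)
    finally have "poly q t = 0" .
    moreover have "q \<in> polys_over (adjoin K X)"
      unfolding polys_over_def mem_Collect_eq coeff_q
    proof (intro allI subring_of_sum[OF L] subring_of_mult[OF L])
      fix j m
      show "Poly_Mapping.lookup p m \<in> adjoin K X"
        using coeff_K KX by blast
      assume "m \<in> {m \<in> Poly_Mapping.keys p. Poly_Mapping.lookup m t = j}"
      then have "Poly_Mapping.keys (rest m) \<subseteq> adjoin K X"
        using keys_X KX by blast
      then show "mon (rest m) \<in> adjoin K X"
        unfolding mon_def by (intro subring_of_prod[OF L] subring_of_power[OF L]) blast
    qed
    ultimately have "q = 0"
      using t by (auto simp: algebraic_over_def)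
    show "p = 0"
    proof (rule ccontr)
      assume "p \<noteq> 0"
      then obtain m0 where m0: "m0 \<in> Poly_Mapping.keys p"
        by (metis ex_in_conv keys_eq_empty)
      define M where
        "M = {m \<in> Poly_Mapping.keys p. Poly_Mapping.lookup m t = Poly_Mapping.lookup m0 t}"
      have "finite M" by (simp add: M_def)
      have inj: "inj_on rest M"
      proof (rule inj_onI, rule poly_mapping_eqI)
        fix m m' x assume "m \<in> M" "m' \<in> M" "rest m = rest m'"
        then show "Poly_Mapping.lookup m x = Poly_Mapping.lookup m' x"
          using rest[of m x] rest[of m' x] by (cases "x = t") (simp_all add: M_def)
      qed
      \<comment> \<open>The group of terms of \<open>p\<close> in which \<open>t\<close> has the same exponent as in \<open>m0\<close>; within it,
        removing the power of \<open>t\<close> does not identify distinct monomials.\<close>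
      define r where "r = (\<Sum>m\<in>M. Poly_Mapping.single (rest m) (Poly_Mapping.lookup p m))"
      have r_rest: "Poly_Mapping.lookup r (rest m) = Poly_Mapping.lookup p m" if "m \<in> M" for m
      proof -
        have "Poly_Mapping.lookup r (rest m)
            = (\<Sum>m'\<in>M. if m' = m then Poly_Mapping.lookup p m' else 0)"
          unfolding r_def lookup_sum
          by (intro sum.cong refl) (use inj that in \<open>auto simp: lookup_single when_def inj_on_def\<close>)
        then show ?thesis using that \<open>finite M\<close> by simp
      qed
      have r_other: "Poly_Mapping.lookup r k = 0" if "k \<notin> rest ` M" for k
        unfolding r_def lookup_sum using that
        by (intro sum.neutral) (auto simp: lookup_single when_def)
      have "r \<in> mpolys_over K X"
        unfolding mpolys_over_def
      proof (intro CollectI conjI allI ballI)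
        show "Poly_Mapping.lookup r k \<in> K" for k
          using r_rest r_other coeff_K subring_of_0[OF subfield_of_subring[OF K]]
          by (cases "k \<in> rest ` M") auto
        fix k assume "k \<in> Poly_Mapping.keys r"
        then have "k \<in> rest ` M" using r_other by (auto simp: in_keys_iff)
        then show "Poly_Mapping.keys k \<subseteq> X" using keys_X by (auto simp: M_def)
      qed
      moreover have "eval_self r = 0"
      proof -
        have "eval_self r = (\<Sum>k\<in>rest ` M. Poly_Mapping.lookup r k * mon k)"
          unfolding eval_self_def mon_def
          by (rule sum.mono_neutral_left) (use \<open>finite M\<close> r_other in \<open>auto simp: in_keys_iff\<close>)
        also have "\<dots> = (\<Sum>m\<in>M. Poly_Mapping.lookup p m * mon (rest m))"
          using r_rest by (simp add: sum.reindex[OF inj])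
        also have "\<dots> = coeff q (Poly_Mapping.lookup m0 t)"
          by (simp add: coeff_q M_def)
        finally show ?thesis using \<open>q = 0\<close> by simp
      qed
      ultimately have "r = 0"
        using ind by (auto simp: algebraically_independent_def)
      then have "Poly_Mapping.lookup p m0 = 0"
        using r_rest[of m0] m0 by (simp add: M_def)
      then show False using m0 by (simp add: in_keys_iff)
    qed
  qed
qed

lemma algebraically_independent_empty:
  "algebraically_independent K {}"
  unfolding algebraically_independent_def
proof (intro ballI impI)
  fix p assume p: "p \<in> mpolys_over K {}" and "eval_self p = 0"
  have keys: "Poly_Mapping.keys p \<subseteq> {0}"
    using p by (auto simp: mpolys_over_def)
  have "eval_self p = (\<Sum>m\<in>{0}. Poly_Mapping.lookup p m
      * (\<Prod>x\<in>Poly_Mapping.keys m. x ^ Poly_Mapping.lookup m x))"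
    unfolding eval_self_def
    by (rule sum.mono_neutral_left) (use keys in \<open>auto simp: in_keys_iff\<close>)
  with \<open>eval_self p = 0\<close> have "Poly_Mapping.lookup p 0 = 0" by simp
  then have "0 \<notin> Poly_Mapping.keys p" by (simp add: in_keys_iff)
  with keys have "Poly_Mapping.keys p = {}" by blast
  then show "p = 0" by simp
qed

lemma Frac_A1_star:
  fixes A :: "'b::idom set"
  assumes A: "subring_of A" and "R \<in> A1_star A"
  obtains t where "\<not> algebraic_over (Frac R) t" "Frac A = adjoin (Frac R) {t}"
proof -
  have R: "subring_of R" "R \<subseteq> A"
    and "polynomial_ring_in_one_variable (Frac R) (localization (R - {0}) A)"
    using assms by (auto simp: A1_star_def)
  then obtain t where t: "\<not> algebraic_over (Frac R) t"
    "localization (R - {0}) A = (\<lambda>p. poly p t) ` polys_over (Frac R)"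
    unfolding polynomial_ring_in_one_variable_def by blast
  note K = subfield_of_subring[OF subfield_of_Frac[OF R(1)]]
  have "Frac A = adjoin (Frac R) {t}"
  proof (rule equalityI)
    have up: "Frac R \<subseteq> adjoin (Frac R) {t}" "t \<in> adjoin (Frac R) {t}"
      using adjoin_upper[of "Frac R" "{t}"] by simp_all
    have sub: "localization (R - {0}) A \<subseteq> adjoin (Frac R) {t}"
      unfolding t(2)
      using poly_in_subring[OF subfield_of_subring[OF subfield_of_adjoin] _ up(2)]
        polys_over_mono[OF up(1)] by blast
    show "Frac A \<subseteq> adjoin (Frac R) {t}"
    proof
      fix x assume "x \<in> Frac A"
      then obtain a s where x: "a \<in> A" "s \<in> A" "x = Fract a s"
        unfolding mem_Frac by blast
      have "Fract a 1 \<in> adjoin (Frac R) {t}" "Fract s 1 \<in> adjoin (Frac R) {t}"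
        using Fract_1_in_localization[OF R(1)] x sub by blast+
      then show "x \<in> adjoin (Frac R) {t}"
        unfolding x(3) by (subst Fract_eq_divide) (rule subfield_of_divide[OF subfield_of_adjoin])
    qed
    have "[:0, 1:] \<in> polys_over (Frac R)"
      using subring_of_0[OF K] subring_of_1[OF K]
      by (simp add: polys_over_pCons) (simp add: polys_over_def)
    then have "poly [:0, 1:] t \<in> localization (R - {0}) A"
      unfolding t(2) by (rule imageI)
    then have "t \<in> Frac A"
      using localization_subset_Frac[OF R(2)] by auto
    then show "adjoin (Frac R) {t} \<subseteq> Frac A"
      by (intro adjoin_least subfield_of_Frac A Frac_mono R(2)) simp
  qed
  with t(1) that show thesis by blast
qed

lemma purely_transcendental_step:
  assumes K: "subfield_of K" and "purely_transcendental K L n" and "\<not> algebraic_over L t"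
  shows "purely_transcendental K (adjoin L {t}) (Suc n)"
proof -
  obtain X where X: "finite X" "card X = n" "algebraically_independent K X" "L = adjoin K X"
    using assms(2) by (auto simp: purely_transcendental_def)
  have "t \<notin> X" "algebraically_independent K (insert t X)"
    using algebraically_independent_insert[OF K X(3)] assms(3) X(4) by blast+
  moreover have "adjoin L {t} = adjoin K (insert t X)"
    by (simp add: X(4) adjoin_adjoin)
  ultimately show ?thesis
    unfolding purely_transcendental_def using X(1,2) by (intro exI[of _ "insert t X"]) simp
qed

lemma CHAR_algebra:
  fixes scale :: "'k::field_char_0 \<Rightarrow> 'b::idom \<Rightarrow> 'b"
  assumes "commutative_algebra scale"
  shows "CHAR('b) = 0"
proof -
  interpret commutative_algebra scale by fact
  have "of_nat m = scale (of_nat m) 1" for m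
    by (induction m) (simp_all add: scale_left_distrib)
  then have "of_nat m \<noteq> (0::'b)" if "m > 0" for m
    using that by (simp add: scale_eq_0_iff)
  then show ?thesis by (simp add: CHAR_eq0_iff)
qed

section \<open>Chains of kernel rings\<close>

theorem corollary4p9:
  fixes scale :: "'k::field_char_0 \<Rightarrow> 'b::{idom, factorial_semiring} \<Rightarrow> 'b"
    and A :: "nat \<Rightarrow> 'b set"
    and n :: nat
  assumes "affine_algebra scale"
    and "n \<ge> 1"
    and "\<forall>i\<in>{0..n}. A i \<in> kernel_rings"
    and "\<forall>i\<in>{1..n}. A (i - 1) \<subset> A i"
    and "\<forall>i\<in>{1..n}. has_trdeg (A i) (A (i - 1)) 1"
  shows "(\<forall>i\<in>{1..n}. A (i - 1) \<in> A1_star (A i)) \<and>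
         purely_transcendental (Frac (A 0)) (Frac (A n)) n"
proof -
  have char: "CHAR('b) = 0"
    using assms(1) CHAR_algebra by (auto simp: affine_algebra_def)
  have step: "A (i - 1) \<in> A1_star (A i)" if "i \<in> {1..n}" for i
    using that assms(3-5) by (intro kernel_rings_trdeg_1_in_A1_star char) auto
  have sub: "subring_of (A i)" if "i \<le> n" for i
    using that assms(3) by (intro kernel_rings_subring) auto
  have K: "subfield_of (Frac (A 0))"
    by (intro subfield_of_Frac sub) simp
  have "purely_transcendental (Frac (A 0)) (Frac (A j)) j" if "j \<le> n" for j
    using that
  proof (induction j)
    case 0
    show ?case
      unfolding purely_transcendental_def
      by (intro exI[of _ "{}"]) (simp add: algebraically_independent_empty adjoin_empty K)
  next
    case (Suc j)
    have "A j \<in> A1_star (A (Suc j))"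
      using step[of "Suc j"] Suc.prems by simp
    then obtain t where "\<not> algebraic_over (Frac (A j)) t"
      "Frac (A (Suc j)) = adjoin (Frac (A j)) {t}"
      using Frac_A1_star[OF sub[OF Suc.prems]] by blast
    then show ?case
      using purely_transcendental_step[OF K Suc.IH] Suc.prems by simp
  qed
  with step show ?thesis by blast
qed

end
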